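(* Let $K$ be a number field with ring of integers $\mathcal{O}_K$ and let $m$ be a positive integer. The only non-singular matrix in $M_m(\mathcal{O}_K)$ that is an $n$-th power in $M_m(\mathcal{O}_K)$ for all but finitely many positive integers $n$ is the identity matrix.
   Context: A number field is a finite extension of $\mathbb{Q}$, and its ring of integers consists of the algebraic integers it contains. Non-singular means having non-zero determinant. $M_m(\mathcal{O}_K)$ is the ring of $m\times m$ matrices over $\mathcal{O}_K$. *)

theory Defs
  imports
    "HOL-Computational_Algebra.Polynomial"
    "Jordan_Normal_Form.Determinant"
begin

text \<open>
  Number fields are represented as subsets of an arbitrary ambient field of characteristic zero.
  The ambient type may be the number field itself (\<open>K = UNIV\<close>), so no embedding into the
  complex numbers is presupposed.
\<close>

definition subfield_set :: "'a::field_char_0 set \<Rightarrow> bool" where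
  "subfield_set K \<longleftrightarrow>
     0 \<in> K \<and> 1 \<in> K \<and>
     (\<forall>x\<in>K. \<forall>y\<in>K. x + y \<in> K \<and> x * y \<in> K) \<and>
     (\<forall>x\<in>K. - x \<in> K \<and> inverse x \<in> K)"

definition number_field :: "'a::field_char_0 set \<Rightarrow> bool" where
  "number_field K \<longleftrightarrow>
     subfield_set K \<and>
     (\<exists>B. finite B \<and> K = module.span (\<lambda>(q::rat) x. of_rat q * x) B)"

definition ring_of_integers :: "'a::field_char_0 set \<Rightarrow> 'a set" where
  "ring_of_integers K = {x \<in> K. algebraic_int x}"

definition square_mats :: "nat \<Rightarrow> 'a set \<Rightarrow> 'a mat set" where
  "square_mats m R = {A \<in> carrier_mat m m. elements_mat A \<subseteq> R}"

text \<open>The locale constant \<^const>\<open>module.span\<close> is only meaningful for an actual module.\<close>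

lemma vector_space_of_rat:
  "vector_space (\<lambda>(q::rat) (x::'a::field_char_0). of_rat q * x)"
  by unfold_locales (simp_all add: algebra_simps of_rat_add of_rat_mult)

end

theory Submission
  imports Defs "Jordan_Normal_Form.Char_Poly"
begin

text \<open>
  Fix a large rational prime \<open>p\<close>, coprime to an integer multiple of \<open>det A\<close>. The ring
  \<open>O\<^sub>K / p\<close> is finite, so by the pigeonhole principle every matrix \<open>B\<close> satisfies
  \<open>B\<^sup>i \<equiv> B\<^sup>j\<close> modulo \<open>p\<close> with \<open>i < j \<le> M\<close>, where \<open>M\<close> does not depend on \<open>B\<close>. If \<open>A = B\<^sup>n\<close>
  with \<open>n\<close> a large multiple of \<open>M!\<close>, then \<open>A\<close> is invertible modulo \<open>p\<close>, which allows to cancel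
  powers of \<open>B\<close>: hence \<open>B\<^sup>j\<^sup>-\<^sup>i \<equiv> 1\<close> and \<open>A \<equiv> 1\<close> modulo \<open>p\<close>. A nonzero entry of \<open>A - 1\<close> divides
  a nonzero integer, so it is not divisible by arbitrarily large primes.
\<close>

subsection \<open>Algebraic integers form a ring\<close>

text \<open>Viewing the field as a Z-module makes \<open>int_module.span\<close> the additive
  subgroup generated by a set, the setting for the finiteness criterion of integrality.\<close>

interpretation int_module: Modules.module "\<lambda>(c::int) (x::'a::field_char_0). of_int c * x"
  by unfold_locales (simp_all add: algebra_simps)

text \<open>As a rewrite rule, it would loop with \<open>of_int_mult\<close> and associativity.\<close>
declare int_module.scale_scale [simp del]

text \<open>An eigenvalue is a root of the characteristic polynomial, which is monic and has integer
  coefficients because \<open>char_poly\<close> commutes with the homomorphism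
  \<open>of_int\<close>.\<close>

lemma algebraic_int_root_char_poly:
  fixes C :: "int mat" and x :: "'a::field_char_0"
  assumes C: "C \<in> carrier_mat n n" and ev: "eigenvalue (map_mat of_int C) x"
  shows "algebraic_int x"
proof (rule algebraic_int.intros)
  have hom: "char_poly (map_mat of_int C :: 'a mat) = map_poly of_int (char_poly C)"
    by (rule of_int_hom.char_poly_hom[OF C])
  have C': "map_mat of_int C \<in> carrier_mat n n" using C by simp
  show "lead_coeff (char_poly (map_mat of_int C :: 'a mat)) = 1"
    using degree_monic_char_poly[OF C'] by auto
  show "\<forall>i. coeff (char_poly (map_mat of_int C :: 'a mat)) i \<in> \<int>"
    unfolding hom by (simp add: coeff_map_poly)
  show "poly (char_poly (map_mat of_int C)) x = 0"
    using eigenvalue_root_char_poly[OF C'] ev by blast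
qed

text \<open>The determinant trick: multiplication by \<open>x\<close> acts on the generators through
  an integer matrix, and the vector of generators is an eigenvector for \<open>x\<close>, nonzero
  because of \<open>s\<close>.\<close>

lemma algebraic_int_of_stable_span:
  fixes S :: "'a::field_char_0 set"
  assumes fin: "finite S" and s: "s \<in> S" "s \<noteq> 0"
    and stable: "\<And>s. s \<in> S \<Longrightarrow> x * s \<in> int_module.span S"
  shows "algebraic_int x"
proof -
  obtain w where w: "bij_betw w {0..<card S} S"
    using ex_bij_betw_nat_finite[OF fin] by blast
  have "\<forall>s\<in>S. \<exists>u. x * s = (\<Sum>t\<in>S. of_int (u t) * t)"
    using stable unfolding int_module.span_finite[OF fin] by blast
  then obtain u where u: "\<And>s. s \<in> S \<Longrightarrow> x * s = (\<Sum>t\<in>S. of_int (u s t) * t)"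
    by metis
  \<comment> \<open>Row \<open>i\<close> holds the coefficients of \<open>x * w i\<close> in the
    generators, so that C v = x v.\<close>
  define C where "C = mat (card S) (card S) (\<lambda>(i,j). u (w i) (w j))"
  define v where "v = vec (card S) w"
  have wS: "w i \<in> S" if "i < card S" for i
    using bij_betw_apply[OF w] that by simp
  have C: "C \<in> carrier_mat (card S) (card S)" by (simp add: C_def)
  have "map_mat of_int C *\<^sub>v v = x \<cdot>\<^sub>v v"
  proof (rule eq_vecI)
    fix i assume "i < dim_vec (x \<cdot>\<^sub>v v)"
    then have i: "i < card S" by (simp add: v_def)
    have "(map_mat of_int C *\<^sub>v v) $ i = (\<Sum>j = 0..<card S. of_int (u (w i) (w j)) * w j)"
      using i by (simp add: C_def v_def scalar_prod_def)
    also have "\<dots> = (\<Sum>t\<in>S. of_int (u (w i) t) * t)"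
      by (rule sum.reindex_bij_betw[OF w])
    also have "\<dots> = (x \<cdot>\<^sub>v v) $ i" using i u[OF wS[OF i]] by (simp add: v_def)
    finally show "(map_mat of_int C *\<^sub>v v) $ i = (x \<cdot>\<^sub>v v) $ i" .
  qed (simp add: C_def v_def)
  moreover have "v \<noteq> 0\<^sub>v (card S)"
  proof
    assume v0: "v = 0\<^sub>v (card S)"
    obtain i where "i < card S" "w i = s"
      using s(1) bij_betw_imp_surj_on[OF w] by (metis atLeastLessThan_iff imageE)
    then show False using s(2) arg_cong[OF v0, of "\<lambda>v. v $ i"] by (simp add: v_def)
  qed
  ultimately have "eigenvalue (map_mat of_int C) x"
    unfolding eigenvalue_def eigenvector_def using C by (intro exI[of _ v]) (simp add: v_def)
  then show ?thesis by (rule algebraic_int_root_char_poly[OF C])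
qed

lemma algebraic_int_power_eq:
  fixes x :: "'a::field_char_0"
  assumes "algebraic_int x"
  obtains d and a :: "nat \<Rightarrow> int" where "d > 0" "x ^ d = (\<Sum>i<d. of_int (a i) * x ^ i)"
proof -
  obtain p :: "int poly" where p: "poly (map_poly of_int p) x = 0" "lead_coeff p = 1"
    using assms unfolding algebraic_int_altdef_ipoly by blast
  define d where "d = degree p"
  have eq: "(\<Sum>i<d. of_int (coeff p i) * x ^ i) + x ^ d = 0"
    using p by (simp add: poly_altdef coeff_map_poly d_def lessThan_Suc_atMost[symmetric])
  \<comment> \<open>For d = 0 the relation would read 1 = 0.\<close>
  moreover have "d > 0" using eq by (cases d) auto
  moreover have "x ^ d = (\<Sum>i<d. of_int (- coeff p i) * x ^ i)"
    using eq by (simp add: sum_negf eq_neg_iff_add_eq_0 add.commute)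
  ultimately show ?thesis by (intro that)
qed

text \<open>Multiplication by \<open>x\<close> is additive and commutes with integer scalars, so
  stability need only be checked on generators.\<close>

lemma int_span_mult:
  assumes "\<And>s. s \<in> S \<Longrightarrow> x * s \<in> int_module.span S" and "z \<in> int_module.span S"
  shows "x * z \<in> int_module.span S"
  using assms(2)
proof (induction rule: int_module.span_induct_alt)
  case base
  then show ?case by (simp add: int_module.span_zero)
next
  case (step c s z)
  have "of_int c * (x * s) + x * z \<in> int_module.span S"
    using step assms(1) by (intro int_module.span_add int_module.span_scale)
  then show ?case by (simp add: algebra_simps)
qed

text \<open>The monomials x^i y^j with i < d and j < e work: multiplying by \<open>x\<close> or
  \<open>y\<close> leaves this range only at the top exponent, where the monic equation lowers the
  degree. A common span handles the sum and the product at once.\<close>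

lemma algebraic_int_common_span:
  fixes x y :: "'a::field_char_0"
  assumes "algebraic_int x" and "algebraic_int y"
  obtains S where "finite S" "1 \<in> S"
    "\<And>s. s \<in> S \<Longrightarrow> x * s \<in> int_module.span S" "\<And>s. s \<in> S \<Longrightarrow> y * s \<in> int_module.span S"
proof -
  obtain d a where d: "d > 0" "x ^ d = (\<Sum>i<d. of_int (a i) * x ^ i)"
    using algebraic_int_power_eq[OF assms(1)] .
  obtain e b where e: "e > 0" "y ^ e = (\<Sum>i<e. of_int (b i) * y ^ i)"
    using algebraic_int_power_eq[OF assms(2)] .
  define S where "S = (\<lambda>(i,j). x ^ i * y ^ j) ` ({..<d} \<times> {..<e})"
  have mem: "x ^ i * y ^ j \<in> int_module.span S" if "i < d" "j < e" for i j
    by (rule int_module.span_base) (use that in \<open>auto simp: S_def\<close>)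
  have "x * s \<in> int_module.span S" "y * s \<in> int_module.span S" if "s \<in> S" for s
  proof -
    from that obtain i j where ij: "i < d" "j < e" "s = x ^ i * y ^ j" by (auto simp: S_def)
    have "x ^ Suc i * y ^ j \<in> int_module.span S"
    proof (cases "Suc i < d")
      case False
      then have "Suc i = d" using ij by simp
      then have "x ^ Suc i * y ^ j = (\<Sum>i<d. of_int (a i) * (x ^ i * y ^ j))"
        using d(2) by (simp add: sum_distrib_right mult.assoc)
      also have "\<dots> \<in> int_module.span S"
        using ij by (intro int_module.span_sum int_module.span_scale mem) auto
      finally show ?thesis .
    qed (use ij mem in blast)
    then show "x * s \<in> int_module.span S" using ij by (simp add: mult.assoc)
    have "x ^ i * y ^ Suc j \<in> int_module.span S"
    proof (cases "Suc j < e")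
      case False
      then have "Suc j = e" using ij by simp
      then have "x ^ i * y ^ Suc j = (\<Sum>j<e. of_int (b j) * (x ^ i * y ^ j))"
        using e(2) by (simp add: sum_distrib_left mult_ac)
      also have "\<dots> \<in> int_module.span S"
        using ij by (intro int_module.span_sum int_module.span_scale mem) auto
      finally show ?thesis .
    qed (use ij mem in blast)
    then show "y * s \<in> int_module.span S" using ij by (simp add: mult_ac)
  qed
  moreover have "1 \<in> S" using d(1) e(1) by (force simp: S_def image_iff intro: bexI[of _ 0])
  moreover have "finite S" by (simp add: S_def)
  ultimately show ?thesis by (intro that)
qed

lemma algebraic_int_add:
  fixes x y :: "'a::field_char_0"
  assumes "algebraic_int x" and "algebraic_int y"
  shows "algebraic_int (x + y)"
proof -
  obtain S where "finite S" "1 \<in> S"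
    "\<And>s. s \<in> S \<Longrightarrow> x * s \<in> int_module.span S" "\<And>s. s \<in> S \<Longrightarrow> y * s \<in> int_module.span S"
    using algebraic_int_common_span[OF assms] by metis
  then show ?thesis
    by (intro algebraic_int_of_stable_span[of S 1])
      (auto simp: distrib_right intro: int_module.span_add)
qed

lemma algebraic_int_mult:
  fixes x y :: "'a::field_char_0"
  assumes "algebraic_int x" and "algebraic_int y"
  shows "algebraic_int (x * y)"
proof -
  obtain S where "finite S" "1 \<in> S"
    "\<And>s. s \<in> S \<Longrightarrow> x * s \<in> int_module.span S" "\<And>s. s \<in> S \<Longrightarrow> y * s \<in> int_module.span S"
    using algebraic_int_common_span[OF assms] by metis
  then show ?thesis
    by (intro algebraic_int_of_stable_span[of S 1])
      (auto simp: mult.assoc intro: int_span_mult)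
qed

subsection \<open>Principal ideals in the ring of integers\<close>

text \<open>Closure under differences yields zero, negatives and sums. The principal ideal generated
  by \<open>a\<close> is written below as the image of \<open>R\<close> under multiplication by
  \<open>a\<close>.\<close>

locale subring_set =
  fixes R :: "'a::comm_ring_1 set"
  assumes one_mem: "1 \<in> R"
    and diff_mem: "x \<in> R \<Longrightarrow> y \<in> R \<Longrightarrow> x - y \<in> R"
    and mult_mem: "x \<in> R \<Longrightarrow> y \<in> R \<Longrightarrow> x * y \<in> R"
begin

lemma zero_mem: "0 \<in> R"
  using diff_mem[OF one_mem one_mem] by simp

lemma uminus_mem: "x \<in> R \<Longrightarrow> - x \<in> R"
  using diff_mem[OF zero_mem] by simp

lemma add_mem: "x \<in> R \<Longrightarrow> y \<in> R \<Longrightarrow> x + y \<in> R"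
  using diff_mem[of x "- y"] uminus_mem by simp

lemma sum_mem: "(\<And>i. i \<in> A \<Longrightarrow> f i \<in> R) \<Longrightarrow> sum f A \<in> R"
  by (induction A rule: infinite_finite_induct) (auto simp: zero_mem add_mem)

lemma prod_mem: "(\<And>i. i \<in> A \<Longrightarrow> f i \<in> R) \<Longrightarrow> prod f A \<in> R"
  by (induction A rule: infinite_finite_induct) (auto simp: one_mem mult_mem)

lemma power_mem: "x \<in> R \<Longrightarrow> x ^ n \<in> R"
  by (induction n) (auto simp: one_mem mult_mem)

lemma of_nat_mem: "of_nat n \<in> R"
  by (induction n) (auto simp: zero_mem one_mem add_mem)

lemma of_int_mem: "of_int n \<in> R"
  by (cases n rule: int_cases2) (auto simp: of_nat_mem uminus_mem)

lemma principal_ideal_diff: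
  assumes "x \<in> (*) a ` R" "y \<in> (*) a ` R"
  shows "x - y \<in> (*) a ` R"
  using assms diff_mem by (auto simp: right_diff_distrib[symmetric])

lemma principal_ideal_add:
  assumes "x \<in> (*) a ` R" "y \<in> (*) a ` R"
  shows "x + y \<in> (*) a ` R"
  using assms add_mem by (auto simp: distrib_left[symmetric])

lemma principal_ideal_mult:
  assumes "x \<in> R" "y \<in> (*) a ` R"
  shows "x * y \<in> (*) a ` R"
  using assms mult_mem by (auto simp: mult.left_commute)

text \<open>With u N + v p = 1, the element x equals u (N x) + p (v x), and both summands lie in the
  ideal. Thus \<open>N\<close> acts invertibly modulo \<open>p\<close>.\<close>

lemma principal_ideal_cancel:
  assumes "coprime N p" and "x \<in> R" and "of_int N * x \<in> (*) (of_int p) ` R"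
  shows "x \<in> (*) (of_int p) ` R"
proof -
  obtain u v where uv: "u * N + v * p = 1"
    using bezout_int[of N p] assms(1) by (metis coprime_iff_gcd_eq_1)
  have "x = of_int (u * N + v * p) * x" using uv by simp
  also have "\<dots> = of_int u * (of_int N * x) + of_int p * (of_int v * x)"
    by (simp add: algebra_simps)
  also have "\<dots> \<in> (*) (of_int p) ` R"
    by (rule principal_ideal_add)
      (use assms in \<open>auto intro: principal_ideal_mult of_int_mem mult_mem\<close>)
  finally show ?thesis .
qed

end

lemma subring_ring_of_integers:
  assumes "number_field K"
  shows "subring_set (ring_of_integers K)"
proof
  have K: "subfield_set K" using assms by (simp add: number_field_def)
  show "1 \<in> ring_of_integers K" using K by (simp add: ring_of_integers_def subfield_set_def)
  fix x y assume xy: "x \<in> ring_of_integers K" "y \<in> ring_of_integers K"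
  have "x + - y \<in> K" using xy K unfolding ring_of_integers_def subfield_set_def by blast
  moreover have "algebraic_int (x + - y)"
    using xy by (intro algebraic_int_add) (auto simp: ring_of_integers_def)
  ultimately show "x - y \<in> ring_of_integers K" by (simp add: ring_of_integers_def)
  show "x * y \<in> ring_of_integers K"
    using xy K algebraic_int_mult by (auto simp: ring_of_integers_def subfield_set_def)
qed

text \<open>A substitute for the norm: once powers of the variable are stripped from an integer
  polynomial vanishing at \<open>x\<close>, its nonzero constant term is a multiple of
  \<open>x\<close> in the ring.\<close>

lemma ring_of_integers_divides_int:
  assumes K: "number_field K" and x: "x \<in> ring_of_integers K" "x \<noteq> 0"
  obtains y N where "y \<in> ring_of_integers K" "N \<noteq> 0" "y * x = of_int N"
proof -
  interpret subring_set "ring_of_integers K" by (rule subring_ring_of_integers[OF K])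
  obtain p :: "int poly" where p: "poly (map_poly of_int p) x = 0" "lead_coeff p = 1"
    using x unfolding ring_of_integers_def algebraic_int_altdef_ipoly by blast
  have "\<exists>y N. y \<in> ring_of_integers K \<and> N \<noteq> 0 \<and> y * x = of_int N"
    if "p \<noteq> 0" "poly (map_poly of_int p) x = 0" for p :: "int poly"
    using that
  proof (induction p)
    case (pCons c q)
    have eq: "of_int c + x * poly (map_poly of_int q) x = 0"
      using pCons.prems by (simp add: of_int_hom.map_poly_pCons_hom)
    \<comment> \<open>If \<open>c\<close> vanishes, cancelling \<open>x\<close> shows that
      \<open>q\<close> vanishes at \<open>x\<close> too, and induction applies. Otherwise c = - q(x)
      x, so - q(x) is the cofactor.\<close>
    show ?case
    proof (cases "c = 0")
      case True
      then show ?thesis using pCons eq x by auto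
    next
      case False
      have "- poly (map_poly of_int q) x \<in> ring_of_integers K"
        using x unfolding poly_altdef
        by (intro uminus_mem sum_mem mult_mem power_mem) (simp_all add: coeff_map_poly of_int_mem)
      moreover have "- poly (map_poly of_int q) x * x = of_int c"
        using eq by (metis add_eq_0_iff2 minus_mult_left mult.commute)
      ultimately show ?thesis using False by blast
    qed
  qed simp
  moreover have "p \<noteq> 0" using p by auto
  ultimately show ?thesis using p that by blast
qed

subsection \<open>Finiteness of the ring of integers modulo a prime\<close>

text \<open>Turns linear relations over the rationals into relations over the integers.\<close>

lemma common_denominator:
  fixes u :: "'b \<Rightarrow> rat"
  assumes "finite S"
  obtains D :: int and k where "D \<noteq> 0" "\<And>s. s \<in> S \<Longrightarrow> of_int D * u s = of_int (k s)"
proof -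
  have "\<exists>D::int. D \<noteq> 0 \<and> (\<forall>s\<in>S. of_int D * u s \<in> \<int>)"
    using assms
  proof induction
    case empty
    show ?case by (intro exI[of _ 1]) simp
  next
    case (insert s S)
    then obtain D :: int where D: "D \<noteq> 0" "\<forall>s\<in>S. of_int D * u s \<in> \<int>" by blast
    obtain a b where "quotient_of (u s) = (a, b)" by fastforce
    then have ab: "u s = of_int a / of_int b" "b > 0"
      by (rule quotient_of_div, rule quotient_of_denom_pos)
    have "of_int (D * b) * u s = of_int (D * a)" using ab by simp
    then have "of_int (D * b) * u s \<in> \<int>" by (simp only: Ints_of_int)
    moreover have "of_int (D * b) * u t \<in> \<int>" if "t \<in> S" for t
    proof -
      have "of_int (D * b) * u t = of_int b * (of_int D * u t)" by simp
      also have "\<dots> \<in> \<int>" using D(2) that Ints_mult[OF Ints_of_int, of "of_int D * u t" b] by blast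
      finally show ?thesis .
    qed
    ultimately show ?case using D(1) ab(2) by (intro exI[of _ "D * b"]) simp
  qed
  then obtain D :: int where D: "D \<noteq> 0" "\<forall>s\<in>S. of_int D * u s \<in> \<int>" by blast
  then have "\<forall>s\<in>S. \<exists>k. of_int D * u s = of_int k" by (meson Ints_cases)
  then obtain k where "\<forall>s\<in>S. of_int D * u s = of_int (k s)" by (rule bchoice[THEN exE])
  then show ?thesis using that D(1) by blast
qed

text \<open>For prime \<open>p\<close>, this is linear independence over the field with p elements
  of the classes of \<open>S\<close> in R/pR, phrased with integer lifts of the
  coefficients.\<close>

definition independent_mod :: "int \<Rightarrow> 'a::comm_ring_1 set \<Rightarrow> 'a set \<Rightarrow> bool" where
  "independent_mod p R S \<longleftrightarrow> finite S \<and> S \<subseteq> R \<and>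
     (\<forall>c::'a \<Rightarrow> int. (\<Sum>s\<in>S. of_int (c s) * s) \<in> (*) (of_int p) ` R \<longrightarrow> (\<forall>s\<in>S. p dvd c s))"

lemma independent_modD:
  assumes "independent_mod p R S" "(\<Sum>s\<in>S. of_int (c s) * s) \<in> (*) (of_int p) ` R" "s \<in> S"
  shows "p dvd c s"
  using assms unfolding independent_mod_def by blast

text \<open>Infinite descent: since 0 lies in pR, every coefficient is divisible by
  \<open>p\<close>; dividing the relation by \<open>p\<close> gives another one, so
  \<open>c s\<close> is divisible by all powers of \<open>p\<close>.\<close>

lemma independent_mod_no_int_relation:
  fixes S :: "'a::field_char_0 set"
  assumes S: "independent_mod p R S" and "0 \<in> R" and p: "prime p"
    and rel: "(\<Sum>s\<in>S. of_int (c s) * s) = 0" and s: "s \<in> S"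
  shows "c s = 0"
proof -
  have "p ^ k dvd c s" for k
    using rel
  proof (induction k arbitrary: c)
    case (Suc k)
    have "of_int p * 0 \<in> (*) (of_int p) ` R" using \<open>0 \<in> R\<close> by (rule imageI)
    then have "p dvd c t" if "t \<in> S" for t
      using independent_modD[OF S _ that] Suc.prems by simp
    then have c: "c t = p * (c t div p)" if "t \<in> S" for t using that by simp
    have "of_int p * (\<Sum>t\<in>S. of_int (c t div p) * t) = (\<Sum>t\<in>S. of_int (c t) * t)"
      unfolding sum_distrib_left
    proof (rule sum.cong)
      fix t assume "t \<in> S"
      then have "of_int (c t) = (of_int p * of_int (c t div p) :: 'a)"
        using c by (metis of_int_mult)
      then show "of_int p * (of_int (c t div p) * t) = of_int (c t) * t" by simp
    qed simp
    then have "(\<Sum>t\<in>S. of_int (c t div p) * t) = 0"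
      using Suc.prems p by auto
    then have "p ^ k dvd c s div p" by (rule Suc.IH)
    then show ?case using c[OF s] by (metis mult_dvd_mono dvd_refl power_Suc)
  qed simp
  moreover have "\<not> is_unit p" using p by auto
  \<comment> \<open>A nonzero integer is not divisible by the power of \<open>p\<close> one beyond
    its multiplicity.\<close>
  ultimately show ?thesis
    using power_dvd_iff_le_multiplicity[of "c s" p "Suc (multiplicity p (c s))"] by fastforce
qed

text \<open>A rational relation, cleared of denominators, would contradict the previous descent. So
  independence modulo \<open>p\<close> implies independence over the rationals, which bounds the
  dimension of R/pR without an integral basis.\<close>

lemma independent_mod_card_le:
  fixes B S :: "'a::field_char_0 set"
  assumes B: "finite B" "S \<subseteq> module.span (\<lambda>(q::rat) x. of_rat q * x) B"
    and S: "independent_mod p R S" and R: "0 \<in> R" and p: "prime p"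
  shows "card S \<le> card B"
proof -
  interpret rat_space: vector_space "\<lambda>(q::rat) (x::'a). of_rat q * x"
    by (rule vector_space_of_rat)
  have fin: "finite S" using S by (simp add: independent_mod_def)
  have "rat_space.independent S"
  proof
    assume "rat_space.dependent S"
    then obtain u v where u: "v \<in> S" "u v \<noteq> 0" "(\<Sum>s\<in>S. of_rat (u s) * s) = 0"
      using rat_space.dependent_finite[OF fin] by auto
    obtain D k where D: "D \<noteq> 0" "\<And>s. s \<in> S \<Longrightarrow> of_int D * u s = of_int (k s)"
      using common_denominator[OF fin] by metis
    have k: "(of_int (k s) :: 'a) = of_int D * of_rat (u s)" if "s \<in> S" for s
      using D(2)[OF that, symmetric] by (metis of_rat_mult of_rat_of_int_eq)
    have "(\<Sum>s\<in>S. of_int (k s) * s) = of_int D * (\<Sum>s\<in>S. of_rat (u s) * s)"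
      unfolding sum_distrib_left by (rule sum.cong) (simp_all add: k mult.assoc)
    then have "k v = 0"
      using u independent_mod_no_int_relation[OF S R p] by simp
    then show False using D(2)[OF u(1)] D(1) u(2) by simp
  qed
  then show ?thesis using rat_space.independent_span_bound[OF B(1) _ B(2)] by blast
qed

text \<open>An independent set modulo \<open>p\<close> of maximal size spans R/pR, and its
  combinations with coefficients in {0..<p} form a finite system of representatives.\<close>

lemma finite_residue_system:
  fixes K :: "'a::field_char_0 set" and p :: int
  assumes K: "number_field K" and p: "prime p"
  obtains F where "finite F"
    "\<And>x. x \<in> ring_of_integers K \<Longrightarrow> \<exists>r\<in>F. x - r \<in> (*) (of_int p) ` ring_of_integers K"
proof -
  define R where "R = ring_of_integers K"
  interpret subring_set R unfolding R_def by (rule subring_ring_of_integers[OF K])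
  obtain B where B: "finite B" "K = module.span (\<lambda>(q::rat) x. of_rat q * x) B"
    using K by (auto simp: number_field_def)
  have "independent_mod p R {}" by (simp add: independent_mod_def)
  \<comment> \<open>The uniform bound ensures that a largest independent set exists, the empty set
    being one candidate.\<close>
  moreover have "card S < Suc (card B)" if "independent_mod p R S" for S
    using that B by (intro le_imp_less_Suc independent_mod_card_le[OF B(1) _ that zero_mem p])
      (auto simp: independent_mod_def R_def ring_of_integers_def)
  ultimately obtain S where S: "independent_mod p R S"
    and max: "\<And>T. independent_mod p R T \<Longrightarrow> card T \<le> card S"
    using ex_has_greatest_nat[of "independent_mod p R" "{}" card "Suc (card B)"] by blast
  have fin: "finite S" and SR: "S \<subseteq> R"
    using S by (auto simp: independent_mod_def)
  define comb where "comb c = (\<Sum>s\<in>S. of_int (c s) * s)" for c :: "'a \<Rightarrow> int"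
  have comb: "\<exists>e. x - comb e \<in> (*) (of_int p) ` R" if x: "x \<in> R" for x
  proof (cases "x \<in> S")
    case True
    have "comb (\<lambda>s. if s = x then 1 else 0) = (\<Sum>s\<in>S. if s = x then x else 0)"
      unfolding comb_def by (rule sum.cong) auto
    also have "\<dots> = x" using fin True by simp
    finally show ?thesis
      by (intro exI[of _ "\<lambda>s. if s = x then 1 else 0"]) (simp add: image_iff zero_mem bexI[of _ 0])
  next
    case False
    then have "\<not> independent_mod p R (insert x S)" using max[of "insert x S"] fin by auto
    then obtain c t where rel: "(\<Sum>s\<in>insert x S. of_int (c s) * s) \<in> (*) (of_int p) ` R"
      and t: "t \<in> insert x S" "\<not> p dvd c t"
      using fin SR x by (auto simp: independent_mod_def)
    have rel: "of_int (c x) * x + comb c \<in> (*) (of_int p) ` R"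
      using rel fin False by (simp add: comb_def)
    \<comment> \<open>If \<open>p\<close> divided \<open>c x\<close>, the relation would restrict to
      \<open>S\<close>, where independence makes all other coefficients divisible by
      \<open>p\<close> as well, contradicting the choice of \<open>t\<close>.\<close>
    have "\<not> p dvd c x"
    proof
      assume "p dvd c x"
      then obtain d where "c x = p * d" ..
      then have d: "of_int (c x) * x = of_int p * (of_int d * x)"
        by (simp only: of_int_mult mult.assoc)
      have "of_int (c x) * x \<in> (*) (of_int p) ` R"
        unfolding d by (intro imageI mult_mem of_int_mem x)
      from principal_ideal_diff[OF rel this] have "comb c \<in> (*) (of_int p) ` R"
        by (simp only: add_diff_cancel_left')
      then show False using independent_modD[OF S, of c t] t \<open>p dvd c x\<close> by (auto simp: comb_def)
    qed
    then have "coprime (c x) p" using p by (metis coprime_commute prime_imp_coprime)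
    then obtain u v where uv: "u * c x + v * p = 1"
      using bezout_int[of "c x" p] by (metis coprime_iff_gcd_eq_1)
    \<comment> \<open>Here \<open>u\<close> inverts \<open>c x\<close> modulo \<open>p\<close>, so
      multiplying the relation by \<open>u\<close> solves it for \<open>x\<close>.\<close>
    have "x - comb (\<lambda>s. - u * c s) = of_int (u * c x + v * p) * x + of_int u * comb c"
      using uv by (simp add: comb_def sum_distrib_left sum_negf mult.assoc)
    also have "\<dots> = of_int u * (of_int (c x) * x + comb c) + of_int p * (of_int v * x)"
      by (simp add: algebra_simps)
    also have "\<dots> \<in> (*) (of_int p) ` R"
      by (intro principal_ideal_add principal_ideal_mult of_int_mem rel imageI mult_mem x)
    finally show ?thesis by blast
  qed
  \<comment> \<open>Restricting the reduced coefficients to \<open>S\<close> places them in a finite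
    space of extensional functions.\<close>
  have red: "comb e - comb (\<lambda>s\<in>S. e s mod p) \<in> (*) (of_int p) ` R" for e
  proof -
    have "of_int (e s) * s - of_int (e s mod p) * s = of_int p * (of_int (e s div p) * s)" for s :: 'a
      by (simp add: left_diff_distrib[symmetric] mult.assoc[symmetric] minus_mod_eq_mult_div
          flip: of_int_diff of_int_mult)
    then have "comb e - comb (\<lambda>s\<in>S. e s mod p) = of_int p * (\<Sum>s\<in>S. of_int (e s div p) * s)"
      by (simp add: comb_def sum_distrib_left sum_subtractf[symmetric])
    moreover have "(\<Sum>s\<in>S. of_int (e s div p) * s) \<in> R"
      using SR by (intro sum_mem mult_mem of_int_mem) auto
    ultimately show ?thesis by (simp only: imageI)
  qed
  have PiE: "(\<lambda>s\<in>S. e s mod p) \<in> S \<rightarrow>\<^sub>E {0..<p}" for e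
    using prime_gt_0_int[OF p] by auto
  have "\<exists>r \<in> comb ` (S \<rightarrow>\<^sub>E {0..<p}). x - r \<in> (*) (of_int p) ` R" if x: "x \<in> R" for x
  proof -
    obtain e where e: "x - comb e \<in> (*) (of_int p) ` R" using comb[OF x] ..
    have "x - comb (\<lambda>s\<in>S. e s mod p) \<in> (*) (of_int p) ` R"
      using principal_ideal_add[OF e red[of e]] by simp
    then show ?thesis using PiE[of e] by blast
  qed
  moreover have "finite (comb ` (S \<rightarrow>\<^sub>E {0..<p}))" using fin by (simp add: finite_PiE)
  ultimately show ?thesis using that unfolding R_def by blast
qed

subsection \<open>Matrices over a subring\<close>

lemma square_mats_iff:
  "A \<in> square_mats m R \<longleftrightarrow> A \<in> carrier_mat m m \<and> (\<forall>i<m. \<forall>j<m. A $$ (i, j) \<in> R)"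
  unfolding square_mats_def by (auto dest!: elements_matD)

lemma square_matsD:
  "A \<in> square_mats m R \<Longrightarrow> A \<in> carrier_mat m m"
  "A \<in> square_mats m R \<Longrightarrow> i < m \<Longrightarrow> j < m \<Longrightarrow> A $$ (i, j) \<in> R"
  by (auto simp: square_mats_iff)

text \<open>The right factor has entries in a set \<open>I\<close> absorbing multiplication by
  \<open>R\<close>; this covers both the subring itself and its principal ideals.\<close>

lemma square_mats_mult:
  fixes A B :: "'a::comm_ring_1 mat"
  assumes A: "A \<in> square_mats m R" and B: "B \<in> square_mats m I"
    and zero: "0 \<in> I" and add: "\<And>x y. x \<in> I \<Longrightarrow> y \<in> I \<Longrightarrow> x + y \<in> I"
    and mult: "\<And>x y. x \<in> R \<Longrightarrow> y \<in> I \<Longrightarrow> x * y \<in> I"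
  shows "A * B \<in> square_mats m I"
proof -
  have sum: "sum f T \<in> I" if "\<And>t. t \<in> T \<Longrightarrow> f t \<in> I" for f :: "nat \<Rightarrow> 'a" and T
    using that by (induction T rule: infinite_finite_induct) (auto simp: zero add)
  have AB: "A \<in> carrier_mat m m" "B \<in> carrier_mat m m"
    using A B by (simp_all add: square_matsD(1))
  have "(A * B) $$ (i, j) \<in> I" if ij: "i < m" "j < m" for i j
  proof -
    have "(A * B) $$ (i, j) = (\<Sum>k = 0..<m. A $$ (i, k) * B $$ (k, j))"
      using AB ij by (simp add: scalar_prod_def)
    also have "\<dots> \<in> I"
      using ij by (intro sum mult square_matsD(2)[OF A] square_matsD(2)[OF B]) auto
    finally show ?thesis .
  qed
  then show ?thesis using AB by (simp add: square_mats_iff)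
qed

lemma pow_mat_add:
  fixes A :: "'a::semiring_1 mat"
  assumes A: "A \<in> carrier_mat m m"
  shows "A ^\<^sub>m (k + l) = A ^\<^sub>m k * A ^\<^sub>m l"
proof (induction l)
  case (Suc l)
  have "A ^\<^sub>m (k + Suc l) = A ^\<^sub>m k * A ^\<^sub>m l * A" using Suc by simp
  also have "\<dots> = A ^\<^sub>m k * (A ^\<^sub>m l * A)"
    by (rule assoc_mult_mat) (use A in auto)
  finally show ?case by simp
qed (use A in \<open>simp add: right_mult_one_mat[OF pow_carrier_mat]\<close>)

lemma pow_mat_mult:
  fixes A :: "'a::semiring_1 mat"
  assumes A: "A \<in> carrier_mat m m"
  shows "A ^\<^sub>m (k * l) = (A ^\<^sub>m k) ^\<^sub>m l"
proof (induction l)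
  case (Suc l)
  have "A ^\<^sub>m (k * Suc l) = A ^\<^sub>m (k * l + k)" by (simp add: add.commute)
  then show ?case using Suc by (simp only: pow_mat_add[OF A] pow_mat.simps)
qed (use A in simp)

lemma finite_square_mats:
  assumes "finite F"
  shows "finite (square_mats m F)"
proof -
  have "square_mats m F \<subseteq> mat m m ` (({..<m} \<times> {..<m}) \<rightarrow>\<^sub>E F)"
  proof
    fix A assume A: "A \<in> square_mats m F"
    have "A = mat m m (restrict (\<lambda>ij. A $$ ij) ({..<m} \<times> {..<m}))"
      using square_matsD(1)[OF A] by (intro eq_matI) auto
    moreover have "restrict (\<lambda>ij. A $$ ij) ({..<m} \<times> {..<m}) \<in> ({..<m} \<times> {..<m}) \<rightarrow>\<^sub>E F"
      using square_matsD(2)[OF A] by auto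
    ultimately show "A \<in> mat m m ` (({..<m} \<times> {..<m}) \<rightarrow>\<^sub>E F)" by blast
  qed
  then show ?thesis by (rule finite_subset) (simp add: assms finite_PiE)
qed

section \<open>Closure properties of matrices over the subring and over its principal ideals\<close>

context subring_set
begin

lemma mult_square_mats:
  assumes "A \<in> square_mats m R" "B \<in> square_mats m R"
  shows "A * B \<in> square_mats m R"
  using assms zero_mem add_mem mult_mem by (rule square_mats_mult)

lemma mult_square_mats_principal_ideal:
  assumes "A \<in> square_mats m R" "B \<in> square_mats m ((*) a ` R)"
  shows "A * B \<in> square_mats m ((*) a ` R)"
proof (rule square_mats_mult[OF assms _ principal_ideal_add principal_ideal_mult])
  show "0 \<in> (*) a ` R" using imageI[OF zero_mem, of "(*) a"] by simp
qed

lemma add_square_mats_principal_ideal: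
  assumes "A \<in> square_mats m ((*) a ` R)" "B \<in> square_mats m ((*) a ` R)"
  shows "A + B \<in> square_mats m ((*) a ` R)"
  unfolding square_mats_iff
proof (intro conjI allI impI)
  show "A + B \<in> carrier_mat m m" using assms by (simp add: square_mats_iff)
  fix i j assume "i < m" "j < m"
  then show "(A + B) $$ (i, j) \<in> (*) a ` R"
    using principal_ideal_add[OF square_matsD(2)[OF assms(1)] square_matsD(2)[OF assms(2)]]
      square_matsD(1)[OF assms(2)] by simp
qed

lemma one_square_mats: "1\<^sub>m m \<in> square_mats m R"
  by (simp add: square_mats_iff one_mem zero_mem)

lemma pow_square_mats: "A \<in> square_mats m R \<Longrightarrow> A ^\<^sub>m k \<in> square_mats m R"
proof (induction k)
  case 0
  then show ?case using one_square_mats square_matsD(1) by fastforce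
qed (simp add: mult_square_mats)

lemma det_mem:
  assumes A: "A \<in> square_mats m R"
  shows "det A \<in> R"
proof -
  have "signof \<pi> \<in> R" for \<pi> :: "nat \<Rightarrow> nat"
    by (cases "signof \<pi> = (1::'a)") (auto simp: sign_def one_mem uminus_mem)
  then show ?thesis
    unfolding det_def'[OF square_matsD(1)[OF A]]
    by (intro sum_mem mult_mem prod_mem square_matsD(2)[OF A])
      (auto dest: permutes_in_image)
qed

text \<open>Cofactors are signed minors, hence in \<open>R\<close>. The adjugate thus inverts
  \<open>A\<close> up to the factor \<open>det A\<close> without leaving \<open>R\<close>.\<close>

lemma adj_square_mats:
  assumes A: "A \<in> square_mats m R"
  shows "adj_mat A \<in> square_mats m R"
proof -
  have Ac: "A \<in> carrier_mat m m" using A by (rule square_matsD)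
  have "cofactor A i j \<in> R" if ij: "i < m" "j < m" for i j
  proof -
    have "mat_delete A i j \<in> square_mats (m - 1) R"
      using Ac ij square_matsD(2)[OF A]
      by (auto simp: square_mats_iff mat_delete_def)
    then show ?thesis
      unfolding cofactor_def by (intro mult_mem power_mem det_mem uminus_mem one_mem)
  qed
  then show ?thesis using Ac by (auto simp: square_mats_iff adj_mat_def)
qed

end

text \<open>Telescoping: X^(k+1) - 1 = X^k (X - 1) + (X^k - 1).\<close>

lemma pow_mat_sub_one:
  fixes X :: "'a::comm_ring_1 mat"
  assumes "subring_set R" and X: "X \<in> square_mats m R"
    and cong: "X - 1\<^sub>m m \<in> square_mats m ((*) a ` R)"
  shows "X ^\<^sub>m k - 1\<^sub>m m \<in> square_mats m ((*) a ` R)"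
proof -
  interpret subring_set R by fact
  have Xc: "X \<in> carrier_mat m m" using X by (rule square_matsD)
  show ?thesis
  proof (induction k)
    case 0
    have "0 \<in> (*) a ` R" using imageI[OF zero_mem, of "(*) a"] by simp
    then show ?case using Xc by (simp add: square_mats_iff minus_carrier_mat)
  next
    case (Suc k)
    have "X ^\<^sub>m k * (X - 1\<^sub>m m) \<in> square_mats m ((*) a ` R)"
      using pow_square_mats[OF X] cong by (rule mult_square_mats_principal_ideal)
    from this Suc have "X ^\<^sub>m k * (X - 1\<^sub>m m) + (X ^\<^sub>m k - 1\<^sub>m m) \<in> square_mats m ((*) a ` R)"
      by (rule add_square_mats_principal_ideal)
    also have "X ^\<^sub>m k * (X - 1\<^sub>m m) + (X ^\<^sub>m k - 1\<^sub>m m) = X ^\<^sub>m Suc k - 1\<^sub>m m"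
    proof -
      have "X ^\<^sub>m k * (X - 1\<^sub>m m) = X ^\<^sub>m k * X - X ^\<^sub>m k"
        using Xc mult_minus_distrib_mat[of "X ^\<^sub>m k" m m X m "1\<^sub>m m"] by simp
      then show ?thesis using Xc by (intro eq_matI) (auto simp del: index_mult_mat(1))
    qed
    finally show ?case .
  qed
qed

subsection \<open>Powers of matrices modulo a prime\<close>

text \<open>Pigeonhole on the powers of \<open>B\<close> reduced entrywise to finitely many
  matrices. The bound \<open>M\<close> is independent of \<open>B\<close>, so an exponent can later
  be fixed before its root \<open>B\<close> is known.\<close>

lemma ex_pow_mat_cong:
  fixes K :: "'a::field_char_0 set" and p :: int
  assumes K: "number_field K" and p: "prime p"
  obtains M where "\<And>B. B \<in> square_mats m (ring_of_integers K) \<Longrightarrow>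
    \<exists>i j. i < j \<and> j \<le> M \<and> B ^\<^sub>m j - B ^\<^sub>m i \<in> square_mats m ((*) (of_int p) ` ring_of_integers K)"
proof -
  define R where "R = ring_of_integers K"
  interpret subring_set R unfolding R_def by (rule subring_ring_of_integers[OF K])
  obtain F where F: "finite F" "\<And>x. x \<in> R \<Longrightarrow> \<exists>r\<in>F. x - r \<in> (*) (of_int p) ` R"
    using finite_residue_system[OF K p] unfolding R_def by metis
  \<comment> \<open>A chosen representative for each element; equal values of \<open>r\<close> force
    congruence modulo \<open>p\<close>.\<close>
  then obtain r where r: "\<And>x. x \<in> R \<Longrightarrow> r x \<in> F" "\<And>x. x \<in> R \<Longrightarrow> x - r x \<in> (*) (of_int p) ` R"
    by metis
  define G where "G = square_mats m F"
  have "finite G" unfolding G_def using F(1) by (rule finite_square_mats)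
  have "\<exists>i j. i < j \<and> j \<le> card G \<and> B ^\<^sub>m j - B ^\<^sub>m i \<in> square_mats m ((*) (of_int p) ` R)"
    if B: "B \<in> square_mats m R" for B
  proof -
    have BR: "B ^\<^sub>m k \<in> square_mats m R" for k using B by (rule pow_square_mats)
    have "(\<lambda>k. map_mat r (B ^\<^sub>m k)) ` {..card G} \<subseteq> G"
      using square_matsD(1)[OF B] square_matsD(2)[OF BR] r(1)
      by (auto simp: G_def square_mats_iff)
    then have "card ((\<lambda>k. map_mat r (B ^\<^sub>m k)) ` {..card G}) \<le> card G"
      using \<open>finite G\<close> by (rule card_mono[rotated])
    \<comment> \<open>The exponents 0 to \<open>card G\<close> are one more than the available
      matrices.\<close>
    then have "\<not> inj_on (\<lambda>k. map_mat r (B ^\<^sub>m k)) {..card G}"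
      by (intro pigeonhole) simp
    then obtain i j where "i < j" "j \<le> card G" and eq: "map_mat r (B ^\<^sub>m i) = map_mat r (B ^\<^sub>m j)"
      unfolding inj_on_def by (metis atMost_iff linorder_neqE_nat)
    moreover have "B ^\<^sub>m j - B ^\<^sub>m i \<in> square_mats m ((*) (of_int p) ` R)"
      unfolding square_mats_iff
    proof (intro conjI allI impI)
      fix k l assume kl: "k < m" "l < m"
      let ?x = "(B ^\<^sub>m j) $$ (k, l)" and ?y = "(B ^\<^sub>m i) $$ (k, l)"
      have "r ?y = r ?x"
        using arg_cong[OF eq, of "\<lambda>A. A $$ (k, l)"] kl square_matsD(1)[OF B] by simp
      then have "?x - ?y = (?x - r ?x) - (?y - r ?y)" by simp
      also have "\<dots> \<in> (*) (of_int p) ` R"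
        by (intro principal_ideal_diff r(2) square_matsD(2)[OF BR] kl)
      finally show "(B ^\<^sub>m j - B ^\<^sub>m i) $$ (k, l) \<in> (*) (of_int p) ` R"
        using kl square_matsD(1)[OF B] by simp
    qed (rule minus_carrier_mat[OF square_matsD(1)[OF BR]])
    ultimately show ?thesis by blast
  qed
  then show ?thesis using that unfolding R_def by blast
qed

text \<open>\<open>C\<close> inverts B^n up to \<open>N\<close>, a unit modulo \<open>p\<close>.
  With e = j - i, the identity N (B^e - 1) = C B^(n-i) (B^j - B^i) gives B^e = 1 modulo
  \<open>p\<close>, and B^n is a power of B^e.\<close>

lemma pow_mat_cong_one:
  fixes R :: "'a::comm_ring_1 set" and p N :: int
  assumes "subring_set R" and B: "B \<in> square_mats m R"
    and C: "C \<in> square_mats m R" "C * B ^\<^sub>m n = of_int N \<cdot>\<^sub>m 1\<^sub>m m" and N: "coprime N p"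
    and cong: "B ^\<^sub>m j - B ^\<^sub>m i \<in> square_mats m ((*) (of_int p) ` R)"
    and ij: "i < j" "i \<le> n" "(j - i) dvd n"
  shows "B ^\<^sub>m n - 1\<^sub>m m \<in> square_mats m ((*) (of_int p) ` R)"
proof -
  interpret subring_set R by fact
  define e where "e = j - i"
  have Bc [simp]: "B \<in> carrier_mat m m" and Cc [simp]: "C \<in> carrier_mat m m"
    using B C by (auto intro: square_matsD)
  have "of_int N \<cdot>\<^sub>m (B ^\<^sub>m e - 1\<^sub>m m) = C * B ^\<^sub>m n * (B ^\<^sub>m e - 1\<^sub>m m)"
    unfolding C(2)
    by (subst mult_smult_assoc_mat[of _ m m _ m]) (simp_all add: left_mult_one_mat[of _ m m] minus_carrier_mat)
  \<comment> \<open>The exponent splits as (n - i) + i because i \<le> n, exposing the factor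
    B^i.\<close>
  also have "\<dots> = C * (B ^\<^sub>m (n - i + i) * (B ^\<^sub>m e - 1\<^sub>m m))"
    using ij by (simp add: assoc_mult_mat[of _ m m _ m _ m] minus_carrier_mat)
  also have "\<dots> = C * (B ^\<^sub>m (n - i) * (B ^\<^sub>m i * (B ^\<^sub>m e - 1\<^sub>m m)))"
    by (subst pow_mat_add[OF Bc]) (simp add: assoc_mult_mat[of _ m m _ m _ m] minus_carrier_mat)
  also have "B ^\<^sub>m i * (B ^\<^sub>m e - 1\<^sub>m m) = B ^\<^sub>m i * B ^\<^sub>m e - B ^\<^sub>m i"
    using mult_minus_distrib_mat[of "B ^\<^sub>m i" m m "B ^\<^sub>m e" m "1\<^sub>m m"]
    by (simp add: right_mult_one_mat[of _ m m])
  also have "B ^\<^sub>m i * B ^\<^sub>m e = B ^\<^sub>m j"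
    using ij by (simp add: e_def flip: pow_mat_add[OF Bc])
  also have "C * (B ^\<^sub>m (n - i) * (B ^\<^sub>m j - B ^\<^sub>m i)) \<in> square_mats m ((*) (of_int p) ` R)"
    by (intro mult_square_mats_principal_ideal C pow_square_mats B cong)
  finally have *: "of_int N \<cdot>\<^sub>m (B ^\<^sub>m e - 1\<^sub>m m) \<in> square_mats m ((*) (of_int p) ` R)" .
  have BR: "B ^\<^sub>m e \<in> square_mats m R" using B by (rule pow_square_mats)
  have "(B ^\<^sub>m e - 1\<^sub>m m) $$ (k, l) \<in> (*) (of_int p) ` R" if kl: "k < m" "l < m" for k l
  proof (rule principal_ideal_cancel[OF N])
    show "(B ^\<^sub>m e - 1\<^sub>m m) $$ (k, l) \<in> R"
      using kl square_matsD(2)[OF BR kl] by (auto intro: diff_mem one_mem)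
    show "of_int N * (B ^\<^sub>m e - 1\<^sub>m m) $$ (k, l) \<in> (*) (of_int p) ` R"
      using square_matsD(2)[OF * kl] kl by simp
  qed
  then have "B ^\<^sub>m e - 1\<^sub>m m \<in> square_mats m ((*) (of_int p) ` R)"
    by (auto simp: square_mats_iff)
  moreover obtain t where "n = e * t" using ij by (auto simp: e_def)
  ultimately show ?thesis
    using pow_mat_sub_one[OF assms(1) BR] pow_mat_mult[OF Bc] by simp
qed

section \<open>Comparison with the identity modulo one large prime\<close>

theorem corollary1p10:
  fixes K :: "'a::field_char_0 set" and m :: nat
  assumes "number_field K" and "m > 0"
  shows "{A \<in> square_mats m (ring_of_integers K).
            det A \<noteq> 0 \<and>
            finite {n::nat. n > 0 \<and> \<not> (\<exists>B \<in> square_mats m (ring_of_integers K). B ^\<^sub>m n = A)}}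
         = {1\<^sub>m m}"
proof -
  define R where "R = ring_of_integers K"
  interpret subring_set R unfolding R_def by (rule subring_ring_of_integers[OF assms(1)])
  have "A = 1\<^sub>m m" if A: "A \<in> square_mats m R" and det: "det A \<noteq> 0"
    and fin: "finite {n::nat. n > 0 \<and> \<not> (\<exists>B \<in> square_mats m R. B ^\<^sub>m n = A)}" for A
  proof (rule ccontr)
    assume "A \<noteq> 1\<^sub>m m"
    have Ac: "A \<in> carrier_mat m m" using A by (rule square_matsD)
    obtain k l where kl: "k < m" "l < m" "A $$ (k, l) \<noteq> 1\<^sub>m m $$ (k, l)"
      using \<open>A \<noteq> 1\<^sub>m m\<close> Ac by (metis carrier_matD eq_matI index_one_mat(2,3))
    define x where "x = (A - 1\<^sub>m m) $$ (k, l)"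
    have x: "x \<in> R" "x \<noteq> 0"
      using kl square_matsD(2)[OF A kl(1,2)] by (auto simp: x_def intro: diff_mem one_mem)
    obtain y N where y: "y \<in> R" "N \<noteq> 0" "y * x = of_int N"
      using ring_of_integers_divides_int[OF assms(1)] x unfolding R_def by metis
    obtain z D where z: "z \<in> R" "D \<noteq> 0" "z * det A = of_int D"
      using ring_of_integers_divides_int[OF assms(1)] det_mem[OF A] det unfolding R_def by metis
    \<comment> \<open>A prime beyond |N D| divides neither \<open>N\<close>, a multiple of the entry
      \<open>x\<close>, nor \<open>D\<close>, a multiple of the determinant.\<close>
    obtain q where q: "prime q" "q > nat \<bar>N * D\<bar>" using bigger_prime by blast
    define p where "p = int q"
    have p: "prime p" "p > \<bar>N * D\<bar>" using q by (auto simp: p_def)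
    have "N * D \<noteq> 0" using y z by simp
    then have "\<not> p dvd N * D" using p(2) by (metis dvd_imp_le_int linorder_not_le abs_of_pos prime_gt_0_int[OF p(1)])
    then have "\<not> p dvd D" "\<not> p dvd N" by auto
    then have "coprime D p" using p(1) by (metis coprime_commute prime_imp_coprime)
    obtain M where M: "\<And>B. B \<in> square_mats m R \<Longrightarrow> \<exists>i j. i < j \<and> j \<le> M \<and>
        B ^\<^sub>m j - B ^\<^sub>m i \<in> square_mats m ((*) (of_int p) ` R)"
      using ex_pow_mat_cong[OF assms(1) p(1), of m] unfolding R_def by metis
    obtain b where b: "\<forall>n\<in>{n. n > 0 \<and> \<not> (\<exists>B \<in> square_mats m R. B ^\<^sub>m n = A)}. n \<le> b"
      using fin unfolding finite_nat_set_iff_bounded_le by blast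
    \<comment> \<open>The factorial makes every difference j - i \<le> M divide \<open>n\<close>;
      the other factor pushes \<open>n\<close> beyond \<open>M\<close> and beyond the bound
      \<open>b\<close> on exceptional exponents.\<close>
    define n where "n = fact M * Suc (M + b)"
    have n: "n > b" "n \<ge> M" "n > 0"
    proof -
      have "Suc (M + b) \<le> n" using mult_le_mono1[OF fact_ge_1[of M], of "Suc (M + b)"] by (simp add: n_def)
      then show "n > b" "n \<ge> M" "n > 0" by auto
    qed
    have "\<exists>B \<in> square_mats m R. B ^\<^sub>m n = A" using bspec[OF b, of n] n by auto
    then obtain B where B: "B \<in> square_mats m R" "B ^\<^sub>m n = A" by blast
    obtain i j where ij: "i < j" "j \<le> M"
      and cong: "B ^\<^sub>m j - B ^\<^sub>m i \<in> square_mats m ((*) (of_int p) ` R)"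
      using M[OF B(1)] by blast
    \<comment> \<open>This matrix times A = B^n is z det A = D times the identity, so it serves as
      the inverse of B^n up to \<open>D\<close>.\<close>
    have "z \<cdot>\<^sub>m adj_mat A \<in> square_mats m R"
      using adj_square_mats[OF A] z(1) by (auto simp: square_mats_iff intro!: mult_mem)
    moreover have "z \<cdot>\<^sub>m adj_mat A * B ^\<^sub>m n = of_int D \<cdot>\<^sub>m 1\<^sub>m m"
      using adj_mat[OF Ac] Ac
      by (simp add: B(2) mult_smult_assoc_mat[of _ m m _ m] flip: z(3)) (auto intro!: eq_matI)
    moreover have "(j - i) dvd n"
      unfolding n_def using ij by (intro dvd_mult2 dvd_fact) auto
    ultimately have "A - 1\<^sub>m m \<in> square_mats m ((*) (of_int p) ` R)"
      using pow_mat_cong_one[OF subring_set_axioms B(1) _ _ \<open>coprime D p\<close> cong ij(1)] ij n B(2)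
      by auto
    then obtain w where w: "w \<in> R" "x = of_int p * w"
      using square_matsD(2) kl unfolding x_def by blast
    \<comment> \<open>The number y w is both rational and an algebraic integer, hence an integer,
      which forces \<open>p\<close> to divide \<open>N\<close>.\<close>
    have "y * w = of_int N / of_int p" using y(3) w(2) p(1) by (auto simp: field_simps)
    moreover have "algebraic_int (y * w)"
      using mult_mem[OF y(1) w(1)] by (simp add: R_def ring_of_integers_def)
    ultimately have "y * w \<in> \<int>"
      by (intro rational_algebraic_int_is_int) auto
    then obtain c where "y * w = of_int c" by (rule Ints_cases)
    then have "of_int N = (of_int (p * c) :: 'a)" using y(3) w(2) by (metis mult.left_commute of_int_mult)
    then have "N = p * c" by (simp only: of_int_eq_iff)
    then show False using \<open>\<not> p dvd N\<close> by simp
  qed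
  \<comment> \<open>Conversely, the identity is its own n-th power for every n, so the exceptional
    set is empty.\<close>
  moreover have "finite {n::nat. n > 0 \<and> \<not> (\<exists>B \<in> square_mats m R. B ^\<^sub>m n = 1\<^sub>m m)}"
  proof -
    have "1\<^sub>m m ^\<^sub>m n = (1\<^sub>m m :: 'a mat)" for n
      by (induction n) auto
    then have "\<exists>B \<in> square_mats m R. B ^\<^sub>m n = 1\<^sub>m m" for n using one_square_mats by blast
    then show ?thesis by simp
  qed
  ultimately show ?thesis
    using one_square_mats unfolding R_def[symmetric] by auto
qed

end
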